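(* If $G$ is a minimally $2$-connected graph of order $n\geq 4$, then $mvd(G)\leq \left\lfloor \frac{n}{2}\right\rfloor$.
   Context: All graphs are finite, simple, undirected and connected. A graph is minimally $2$-connected if it is $2$-connected but $G-e$ is not $2$-connected for every edge $e$. For a vertex-colored graph and two nonadjacent vertices $x,y$, an $x$-$y$ vertex cut is a set $S\subseteq V(G)\setminus\{x,y\}$ such that $x$ and $y$ lie in different components of $G-S$; it is monochromatic if all its vertices have the same color. A vertex-coloring is an MVD-coloring if every pair of nonadjacent vertices has a monochromatic vertex cut separating them. $mvd(G)$ is the maximum number of colors used by an MVD-coloring of $G$. *)

theory Defs
  imports "Graph_Theory.Digraph_Component"
begin

text \<open>
  A finite simple undirected graph is a \<^locale>\<open>pair_graph\<close>: a finite loop-free symmetric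
  digraph without parallel arcs, in which the edge between \<open>u\<close> and \<open>v\<close> is the pair of arcs
  \<open>(u, v)\<close>, \<open>(v, u)\<close>.
\<close>

definition del_verts :: "'a pair_pre_digraph \<Rightarrow> 'a set \<Rightarrow> ('a, 'a \<times> 'a) pre_digraph" where
  "del_verts G S = with_proj G \<restriction> (pverts G - S)"

definition del_edge :: "'a pair_pre_digraph \<Rightarrow> 'a \<Rightarrow> 'a \<Rightarrow> 'a pair_pre_digraph" where
  "del_edge G u v = \<lparr> pverts = pverts G, parcs = parcs G - {(u, v), (v, u)} \<rparr>"

text \<open>The case \<open>X = {}\<close> says that \<open>G\<close> itself is connected.\<close>

definition k_connected :: "nat \<Rightarrow> 'a pair_pre_digraph \<Rightarrow> bool" where
  "k_connected k G \<longleftrightarrow> card (pverts G) > k \<and>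
     (\<forall>X \<subseteq> pverts G. card X < k \<longrightarrow> connected (del_verts G X))"

definition minimally_2_connected :: "'a pair_pre_digraph \<Rightarrow> bool" where
  "minimally_2_connected G \<longleftrightarrow> k_connected 2 G \<and>
     (\<forall>(u, v) \<in> parcs G. \<not> k_connected 2 (del_edge G u v))"

text \<open>
  In a symmetric digraph the components are the strongly connected components, so
  \<^const>\<open>pre_digraph.scc_of\<close> yields the vertex set of the component of a vertex.
\<close>

definition vertex_cut :: "'a pair_pre_digraph \<Rightarrow> 'a \<Rightarrow> 'a \<Rightarrow> 'a set \<Rightarrow> bool" where
  "vertex_cut G x y S \<longleftrightarrow> S \<subseteq> pverts G - {x, y} \<and>
     pre_digraph.scc_of (del_verts G S) x \<noteq> pre_digraph.scc_of (del_verts G S) y"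

definition monochromatic :: "('a \<Rightarrow> 'c) \<Rightarrow> 'a set \<Rightarrow> bool" where
  "monochromatic c S \<longleftrightarrow> (\<forall>u \<in> S. \<forall>v \<in> S. c u = c v)"

definition mvd_coloring :: "'a pair_pre_digraph \<Rightarrow> ('a \<Rightarrow> 'c) \<Rightarrow> bool" where
  "mvd_coloring G c \<longleftrightarrow>
     (\<forall>x \<in> pverts G. \<forall>y \<in> pverts G. x \<noteq> y \<and> (x, y) \<notin> parcs G \<longrightarrow>
        (\<exists>S. vertex_cut G x y S \<and> monochromatic c S))"

text \<open>Colours are natural numbers, which suffices for finite graphs.\<close>

definition mvd :: "'a pair_pre_digraph \<Rightarrow> nat" where
  "mvd G = Max {card (c ` pverts G) | c :: 'a \<Rightarrow> nat. mvd_coloring G c}"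

text \<open>The maximum ranges over a finite nonempty set: constant colourings are MVD-colourings.\<close>

lemma mvd_coloring_const:
  assumes "pair_graph G"
  shows "mvd_coloring G (\<lambda>_. k)"
  unfolding mvd_coloring_def
proof (intro ballI impI exI conjI)
  fix x y assume xy: "x \<in> pverts G" "y \<in> pverts G" "x \<noteq> y \<and> (x, y) \<notin> parcs G"
  let ?H = "del_verts G (pverts G - {x, y})"
  have "z = x" if "x \<rightarrow>\<^sup>*\<^bsub>?H\<^esub> z" for z
    using that unfolding reachable_def
  proof (induction rule: rtrancl_on_induct)
    case (step u v)
    then show ?case
      using xy
      by (auto simp: del_verts_def induce_subgraph_def arcs_ends_def arc_to_ends_def)
  qed simp
  moreover have "y \<rightarrow>\<^sup>*\<^bsub>?H\<^esub> y"
    using xy by (auto simp: reachable_def del_verts_def induce_subgraph_def)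
  ultimately show "vertex_cut G x y (pverts G - {x, y})"
    using xy by (auto simp: vertex_cut_def pre_digraph.scc_of_def)
  show "monochromatic (\<lambda>_. k) (pverts G - {x, y})"
    by (simp add: monochromatic_def)
qed

lemma mvd_set_finite_nonempty:
  assumes "pair_graph G"
  defines "M \<equiv> {card (c ` pverts G) | c :: 'a \<Rightarrow> nat. mvd_coloring G c}"
  shows "finite M" "M \<noteq> {}"
proof -
  have "finite (pverts G)"
    using assms(1) by (simp add: pair_graph_def pair_digraph_def pair_fin_digraph.pair_finite_verts)
  then have "M \<subseteq> {..card (pverts G)}"
    by (auto simp: M_def card_image_le)
  then show "finite M" by (rule finite_subset) simp
  show "M \<noteq> {}" using mvd_coloring_const[OF assms(1), of 0] by (auto simp: M_def)
qed

end

theory Submission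
  imports Defs
begin

text \<open>
  A minimally 2-connected graph on at least four vertices is triangle-free: a vertex outside a
  triangle yields a path joining two of its corners and avoiding the third, and the edge between
  these two corners is then redundant for 2-connectivity. So any two neighbours \<open>x\<close>, \<open>y\<close> of a
  vertex \<open>v\<close> are nonadjacent. Every \<open>x\<close>-\<open>y\<close> cut contains \<open>v\<close>, and it has at least two elements by
  2-connectivity. Hence in an MVD-colouring no colour is used exactly once.
\<close>

section \<open>Reachability after deleting vertices or an edge\<close>

lemma verts_del_verts [simp]: "verts (del_verts G X) = pverts G - X"
  by (simp add: del_verts_def)

lemma arcs_ends_del_verts:
  "arcs_ends (del_verts G X) =
     {(u, v). (u, v) \<in> parcs G \<and> u \<in> pverts G - X \<and> v \<in> pverts G - X}"
  by (auto simp: del_verts_def induce_subgraph_def arcs_ends_def arc_to_ends_def)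

lemma del_edge_sel [simp]:
  "pverts (del_edge G u v) = pverts G"
  "parcs (del_edge G u v) = parcs G - {(u, v), (v, u)}"
  by (simp_all add: del_edge_def)

lemma pair_graph_finite_verts:
  assumes "pair_graph G"
  shows "finite (pverts G)"
  using assms by (simp add: pair_graph_def pair_digraph_def pair_fin_digraph.pair_finite_verts)

lemma pair_graph_arc:
  assumes "pair_graph G" "(u, v) \<in> parcs G"
  shows "u \<in> pverts G" "v \<in> pverts G" "u \<noteq> v" "(v, u) \<in> parcs G"
proof -
  interpret pair_graph G by fact
  show "u \<in> pverts G" "v \<in> pverts G" "u \<noteq> v"
    using assms(2) arc_fst_in_verts arc_snd_in_verts pair_no_loops by force+
  show "(v, u) \<in> parcs G"
    using assms(2) pair_sym_arcs by (auto simp: symmetric_def elim: symE)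
qed

lemma pair_graph_del_edge:
  assumes "pair_graph G"
  shows "pair_graph (del_edge G u v)"
proof -
  interpret pair_graph G by fact
  show ?thesis
  proof
    show "symmetric (del_edge G u v)"
      using pair_graph_arc(4)[OF assms] by (auto simp: symmetric_def intro!: symI)
  qed (auto simp: pair_finite_verts pair_finite_arcs in_arcsD1 in_arcsD2
         dest: pair_graph_arc(3)[OF assms])
qed

lemma sym_digraph_del_verts:
  assumes "pair_graph G"
  shows "sym_digraph (del_verts G X)"
proof -
  interpret pair_graph G by fact
  show ?thesis
    unfolding del_verts_def by (rule induced_graph_imp_graph) (auto intro: induced_induce)
qed

text \<open>\<open>connected\<close> means strong connectivity of the symmetric closure. Here the
  arcs are already symmetric, so passing to the closure leaves reachability unchanged.\<close>

lemma connected_del_verts_iff: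
  assumes "pair_graph G"
  shows "connected (del_verts G X) \<longleftrightarrow> pverts G - X \<noteq> {} \<and>
     (\<forall>u \<in> pverts G - X. \<forall>v \<in> pverts G - X. u \<rightarrow>\<^sup>*\<^bsub>del_verts G X\<^esub> v)"
proof -
  interpret H: sym_digraph "del_verts G X" using assms by (rule sym_digraph_del_verts)
  show ?thesis
    by (simp add: connected_def strongly_connected_def H.reachable_mk_symmetric_eq[OF H.sym_arcs])
qed

text \<open>Only arcs avoiding \<open>X\<close> have to survive in \<open>H\<close>. A walk that
  avoids a triangle therefore persists when an edge of that triangle is deleted.\<close>

lemma reachable_del_verts_mono:
  assumes "u \<rightarrow>\<^sup>*\<^bsub>del_verts G X\<^esub> v" "pverts G - X \<subseteq> pverts H - Y"
    and "\<And>a b. (a, b) \<in> parcs G \<Longrightarrow> a \<notin> X \<Longrightarrow> b \<notin> X \<Longrightarrow> (a, b) \<in> parcs H"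
  shows "u \<rightarrow>\<^sup>*\<^bsub>del_verts H Y\<^esub> v"
  using assms(1) unfolding reachable_def
  by (rule rtrancl_on_mono[rotated 2]) (use assms(2,3) in \<open>auto simp: arcs_ends_del_verts\<close>)

lemma reachable_del_verts_arc:
  assumes "(u, v) \<in> parcs G" "u \<in> pverts G - X" "v \<in> pverts G - X"
  shows "u \<rightarrow>\<^sup>*\<^bsub>del_verts G X\<^esub> v"
  using assms unfolding reachable_def
  by (intro rtrancl_on_into_rtrancl_on[OF rtrancl_on_refl]) (auto simp: arcs_ends_del_verts)

lemma reachable_del_verts_trans:
  assumes "u \<rightarrow>\<^sup>*\<^bsub>del_verts G X\<^esub> v" "v \<rightarrow>\<^sup>*\<^bsub>del_verts G X\<^esub> w"
  shows "u \<rightarrow>\<^sup>*\<^bsub>del_verts G X\<^esub> w"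
  using assms unfolding reachable_def by (rule rtrancl_on_trans)

lemma reachable_del_verts_sym:
  assumes "pair_graph G" "u \<rightarrow>\<^sup>*\<^bsub>del_verts G X\<^esub> v"
  shows "v \<rightarrow>\<^sup>*\<^bsub>del_verts G X\<^esub> u"
  using sym_digraph.sym_arcs[OF sym_digraph_del_verts[OF assms(1)]] assms(2)
  by (rule symmetric_reachable)

text \<open>A walk from \<open>a\<close> to \<open>b\<close> that avoids \<open>X\<close> starts
  inside \<open>A\<close> and ends outside it, so one of its arcs leaves \<open>A\<close>.\<close>

lemma connected_boundary_arc:
  assumes "pair_graph G" "connected (del_verts G X)"
    and "a \<in> A" "a \<in> pverts G - X" "b \<in> pverts G - X" "b \<notin> A"
  obtains u v where "u \<in> A" "v \<notin> A" "u \<notin> X" "v \<notin> X" "(u, v) \<in> parcs G"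
proof -
  have "a \<rightarrow>\<^sup>*\<^bsub>del_verts G X\<^esub> b"
    using assms by (simp add: connected_del_verts_iff)
  then have "b \<in> A \<or> (\<exists>u v. u \<in> A \<and> v \<notin> A \<and> u \<notin> X \<and> v \<notin> X \<and> (u, v) \<in> parcs G)"
    unfolding reachable_def
  proof (induction rule: rtrancl_on_induct)
    case (step y z)
    then show ?case by (auto simp: arcs_ends_del_verts)
  qed (use assms in simp)
  then show ?thesis using assms that by blast
qed

text \<open>In any walk, each use of the deleted edge can be replaced by the detour, reversed if
  necessary. If \<open>X\<close> contains an end of the edge, no walk uses it.\<close>

lemma connected_del_edge:
  assumes G: "pair_graph G" and con: "connected (del_verts G X)"
    and detour: "x \<notin> X \<Longrightarrow> y \<notin> X \<Longrightarrow> x \<rightarrow>\<^sup>*\<^bsub>del_verts (del_edge G x y) X\<^esub> y"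
  shows "connected (del_verts (del_edge G x y) X)"
proof -
  let ?H = "del_edge G x y"
  have H: "pair_graph ?H" using G by (rule pair_graph_del_edge)
  have "u \<rightarrow>\<^sup>*\<^bsub>del_verts ?H X\<^esub> v" if "u \<rightarrow>\<^sup>*\<^bsub>del_verts G X\<^esub> v" for u v
    using that unfolding reachable_def[of "del_verts G X"]
  proof (induction rule: rtrancl_on_induct)
    case base
    then show ?case by (simp add: reachable_def)
  next
    case (step a b)
    then have ab: "(a, b) \<in> parcs G" "a \<in> pverts G - X" "b \<in> pverts G - X"
      by (auto simp: arcs_ends_del_verts)
    have "a \<rightarrow>\<^sup>*\<^bsub>del_verts ?H X\<^esub> b"
    proof (cases "(a, b) = (x, y) \<or> (a, b) = (y, x)")
      case True
      then show ?thesis using ab detour reachable_del_verts_sym[OF H] by blast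
    next
      case False
      then show ?thesis using ab by (intro reachable_del_verts_arc) auto
    qed
    with step.IH show ?case by (rule reachable_del_verts_trans)
  qed
  then show ?thesis
    using con by (simp add: connected_del_verts_iff G H)
qed

lemma k_connected_del_verts:
  assumes "k_connected k G" "X \<subseteq> pverts G" "card X < k"
  shows "connected (del_verts G X)"
  using assms by (simp add: k_connected_def)

section \<open>Triangle-freeness\<close>

text \<open>With such a detour, deleting the edge \<open>x\<close>-\<open>y\<close> would preserve
  2-connectivity: the detour serves when \<open>v\<close> is removed, and the path \<open>x\<close>,
  \<open>v\<close>, \<open>y\<close> serves otherwise.\<close>

lemma minimally_2_connected_triangle_no_detour:
  assumes G: "pair_graph G" and min: "minimally_2_connected G"
    and tri: "(x, y) \<in> parcs G" "(x, v) \<in> parcs G" "(v, y) \<in> parcs G"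
  shows "\<not> x \<rightarrow>\<^sup>*\<^bsub>del_verts (del_edge G x y) {v}\<^esub> y"
proof
  assume detour: "x \<rightarrow>\<^sup>*\<^bsub>del_verts (del_edge G x y) {v}\<^esub> y"
  have k2: "k_connected 2 G" and not_k2: "\<not> k_connected 2 (del_edge G x y)"
    using min tri(1) by (auto simp: minimally_2_connected_def)
  note arc = pair_graph_arc[OF G]
  have "connected (del_verts (del_edge G x y) X)" if X: "X \<subseteq> pverts G" "card X < 2" for X
  proof (rule connected_del_edge[OF G k_connected_del_verts[OF k2 X]])
    assume xy: "x \<notin> X" "y \<notin> X"
    show "x \<rightarrow>\<^sup>*\<^bsub>del_verts (del_edge G x y) X\<^esub> y"
    proof (cases "v \<in> X")
      case True
      \<comment> \<open>Finiteness is needed because \<open>card\<close> is 0 on infinite sets; with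
        \<open>v\<close> in \<open>X\<close> it leaves only \<open>X = {v}\<close>.\<close>
      have "finite X"
        using pair_graph_finite_verts[OF G] X(1) by (rule finite_subset[rotated])
      with True have "card X > 0" by (auto simp: card_gt_0_iff)
      with X(2) have "card X = 1" by simp
      with True have "X = {v}" by (auto simp: card_1_singleton_iff)
      with detour show ?thesis by simp
    next
      case False
      then show ?thesis
        using xy tri arc(1,2,3)[OF tri(1)] arc(1,2,3)[OF tri(2)] arc(1,2,3)[OF tri(3)]
        by (intro reachable_del_verts_trans[OF reachable_del_verts_arc reachable_del_verts_arc, of _ v])
          auto
    qed
  qed
  with k2 have "k_connected 2 (del_edge G x y)" by (simp add: k_connected_def)
  with not_k2 show False ..
qed

text \<open>A component of the graph outside the triangle attaches to two different corners
  \<open>p\<close> and \<open>r\<close>, so a path through it joins them and avoids the third corner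
  \<open>s\<close>.\<close>

lemma minimally_2_connected_triangle_free:
  assumes G: "pair_graph G" and min: "minimally_2_connected G"
    and card: "card (pverts G) \<ge> 4"
    and tri: "(x, y) \<in> parcs G" "(y, z) \<in> parcs G"
  shows "(x, z) \<notin> parcs G"
proof
  assume "(x, z) \<in> parcs G"
  note arc = pair_graph_arc[OF G]
  let ?T = "{x, y, z}"
  have T: "?T \<subseteq> pverts G" "x \<noteq> y" "y \<noteq> z" "x \<noteq> z"
    using arc[OF tri(1)] arc[OF tri(2)] arc[OF \<open>(x, z) \<in> parcs G\<close>] by auto
  have tri': "(p, q) \<in> parcs G" if "p \<in> ?T" "q \<in> ?T" "p \<noteq> q" for p q
    using that tri \<open>(x, z) \<in> parcs G\<close> arc(4) by auto
  have k2: "k_connected 2 G" using min by (simp add: minimally_2_connected_def)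
  have "card ?T < card (pverts G)" using T card by simp
  then have "\<not> pverts G \<subseteq> ?T" using card_mono[of ?T "pverts G"] by auto
  then obtain w0 where w0: "w0 \<in> pverts G" "w0 \<notin> ?T" by blast
  have con0: "connected (del_verts G {})"
    by (rule k_connected_del_verts[OF k2]) auto
  obtain p w where pw: "p \<in> ?T" "w \<notin> ?T" "(p, w) \<in> parcs G"
    by (rule connected_boundary_arc[OF G con0, of x ?T w0]) (use T w0 in auto)
  obtain q where q: "q \<in> ?T" "q \<noteq> p" using T by auto
  \<comment> \<open>The component of \<open>w\<close> after removal of the triangle; it is attached
    to the corner \<open>p\<close>.\<close>
  define A where "A = {a. w \<rightarrow>\<^sup>*\<^bsub>del_verts G ?T\<^esub> a}"
  have pV: "p \<in> pverts G" and wV: "w \<in> pverts G" using arc[OF pw(3)] by auto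
  have wA: "w \<in> A" using pw wV by (simp add: A_def reachable_def)
  have A_sub: "A \<subseteq> pverts G - ?T"
    by (auto simp: A_def reachable_def dest: in_rtrancl_on_in_F)
  \<comment> \<open>Since \<open>p\<close> is no cut vertex, \<open>A\<close> must have an arc
    leaving it that avoids \<open>p\<close>; the corner \<open>q\<close> witnesses that something
    lies outside \<open>A\<close>.\<close>
  have conp: "connected (del_verts G {p})"
    by (rule k_connected_del_verts[OF k2]) (use pV in auto)
  have wp: "w \<in> pverts G - {p}" and qp: "q \<in> pverts G - {p}" and qA: "q \<notin> A"
    using pw q wV T A_sub by auto
  obtain u r where ur: "u \<in> A" "r \<notin> A" "r \<noteq> p" "(u, r) \<in> parcs G"
    by (rule connected_boundary_arc[OF G conp wA wp qp qA]) auto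
  have uT: "u \<in> pverts G - ?T" using ur A_sub by auto
  have rV: "r \<in> pverts G" using arc[OF ur(4)] by simp
  \<comment> \<open>A component is closed under arcs avoiding the triangle, so the arc leaving
    \<open>A\<close> can only end at a corner.\<close>
  have rT: "r \<in> ?T"
  proof (rule ccontr)
    assume "r \<notin> ?T"
    then have "u \<rightarrow>\<^sup>*\<^bsub>del_verts G ?T\<^esub> r"
      using ur uT rV by (intro reachable_del_verts_arc) auto
    with ur(1) have "r \<in> A" unfolding A_def by (auto intro: reachable_del_verts_trans)
    with ur(2) show False ..
  qed
  obtain s where s: "s \<in> ?T" "s \<noteq> p" "s \<noteq> r" using T by auto
  \<comment> \<open>The detour goes from \<open>p\<close> to \<open>w\<close>, through
    \<open>A\<close> to \<open>u\<close>, then to \<open>r\<close>.\<close>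
  let ?H = "del_verts (del_edge G p r) {s}"
  have "p \<rightarrow>\<^sup>*\<^bsub>?H\<^esub> w"
    using pw s rT pV wV by (intro reachable_del_verts_arc) auto
  moreover have "w \<rightarrow>\<^sup>*\<^bsub>?H\<^esub> u"
    using ur(1) unfolding A_def mem_Collect_eq
    by (rule reachable_del_verts_mono) (use s rT pw in auto)
  moreover have "u \<rightarrow>\<^sup>*\<^bsub>?H\<^esub> r"
    using ur uT s rT rV pw by (intro reachable_del_verts_arc) auto
  ultimately have "p \<rightarrow>\<^sup>*\<^bsub>?H\<^esub> r" by (blast intro: reachable_del_verts_trans)
  moreover have "(p, r) \<in> parcs G" "(p, s) \<in> parcs G" "(s, r) \<in> parcs G"
    using tri' pw(1) rT s ur(3) by metis+
  ultimately show False using minimally_2_connected_triangle_no_detour[OF G min] by blast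
qed

section \<open>Colour classes have at least two vertices\<close>

text \<open>Connectivity yields one neighbour \<open>x\<close>; connectivity after deleting
  \<open>x\<close> yields another.\<close>

lemma k_connected_2_two_neighbours:
  assumes G: "pair_graph G" and k2: "k_connected 2 G" and v: "v \<in> pverts G"
  obtains x y where "x \<noteq> y" "(v, x) \<in> parcs G" "(v, y) \<in> parcs G"
proof -
  have card: "card (pverts G) > 2" using k2 by (simp add: k_connected_def)
  have ex: "\<exists>w. w \<in> pverts G \<and> w \<noteq> v \<and> w \<noteq> a" for a
  proof (rule ccontr)
    assume "\<not> ?thesis"
    then have "pverts G \<subseteq> {v, a}" by auto
    from card_mono[OF _ this] card show False by (simp split: if_splits add: card_insert_if)
  qed
  have con0: "connected (del_verts G {})"
    by (rule k_connected_del_verts[OF k2]) auto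
  obtain a where a: "a \<in> pverts G" "a \<noteq> v" using ex by blast
  obtain x where x: "(v, x) \<in> parcs G" "x \<noteq> v"
    by (rule connected_boundary_arc[OF G con0, of v "{v}" a]) (use a v in auto)
  have conx: "connected (del_verts G {x})"
    by (rule k_connected_del_verts[OF k2]) (use pair_graph_arc[OF G x(1)] in auto)
  obtain b where b: "b \<in> pverts G" "b \<noteq> v" "b \<noteq> x" using ex by blast
  obtain y where "(v, y) \<in> parcs G" "y \<noteq> x"
    by (rule connected_boundary_arc[OF G conx, of v "{v}" b]) (use b v x in auto)
  with x that show ?thesis by blast
qed

text \<open>Reachability is symmetric here, so a walk from \<open>x\<close> to \<open>y\<close>
  would put both in the same strongly connected component.\<close>

lemma vertex_cut_not_reachable:
  assumes G: "pair_graph G" and cut: "vertex_cut G x y S"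
  shows "\<not> x \<rightarrow>\<^sup>*\<^bsub>del_verts G S\<^esub> y"
proof
  assume xy: "x \<rightarrow>\<^sup>*\<^bsub>del_verts G S\<^esub> y"
  then have yx: "y \<rightarrow>\<^sup>*\<^bsub>del_verts G S\<^esub> x" by (rule reachable_del_verts_sym[OF G])
  have "pre_digraph.scc_of (del_verts G S) x = pre_digraph.scc_of (del_verts G S) y"
    unfolding pre_digraph.scc_of_def using xy yx by (blast intro: reachable_del_verts_trans)
  with cut show False by (simp add: vertex_cut_def)
qed

lemma mvd_coloring_no_singleton_class:
  assumes G: "pair_graph G" and min: "minimally_2_connected G"
    and card: "card (pverts G) \<ge> 4"
    and col: "mvd_coloring G c" and v: "v \<in> pverts G"
  obtains w where "w \<in> pverts G" "w \<noteq> v" "c w = c v"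
proof -
  have k2: "k_connected 2 G" using min by (simp add: minimally_2_connected_def)
  note arc = pair_graph_arc[OF G]
  obtain x y where xy: "x \<noteq> y" "(v, x) \<in> parcs G" "(v, y) \<in> parcs G"
    using k_connected_2_two_neighbours[OF G k2 v] .
  have xyV: "x \<in> pverts G" "y \<in> pverts G" "x \<noteq> v" "y \<noteq> v"
    using arc[OF xy(2)] arc[OF xy(3)] by auto
  \<comment> \<open>An arc would close a triangle with \<open>v\<close>. Nonadjacency makes the
    colouring supply a monochromatic cut \<open>S\<close>.\<close>
  have "(x, y) \<notin> parcs G"
    by (rule minimally_2_connected_triangle_free[OF G min card arc(4)[OF xy(2)] xy(3)])
  with col xy(1) xyV obtain S where S: "vertex_cut G x y S" "monochromatic c S"
    unfolding mvd_coloring_def by blast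
  have S_sub: "S \<subseteq> pverts G - {x, y}" using S(1) by (simp add: vertex_cut_def)
  note no_reach = vertex_cut_not_reachable[OF G S(1)]
  have "v \<in> S"
  proof (rule ccontr)
    assume "v \<notin> S"
    then have "x \<rightarrow>\<^sup>*\<^bsub>del_verts G S\<^esub> v" "v \<rightarrow>\<^sup>*\<^bsub>del_verts G S\<^esub> y"
      using S_sub xyV v xy arc(4)[OF xy(2)] by (auto intro!: reachable_del_verts_arc)
    with no_reach show False by (blast intro: reachable_del_verts_trans)
  qed
  \<comment> \<open>No single vertex separates a 2-connected graph, so \<open>S\<close> has a second
    vertex, which shares the colour of \<open>v\<close>.\<close>
  have "S \<noteq> {v}"
  proof
    assume "S = {v}"
    moreover have "connected (del_verts G {v})"
      by (rule k_connected_del_verts[OF k2]) (use v in auto)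
    ultimately show False
      using no_reach xyV by (simp add: connected_del_verts_iff[OF G])
  qed
  with \<open>v \<in> S\<close> obtain w where "w \<in> S" "w \<noteq> v" by blast
  with \<open>v \<in> S\<close> S(2) S_sub that show ?thesis unfolding monochromatic_def by blast
qed

section \<open>Counting colours\<close>

text \<open>Every nonempty fibre of \<open>f\<close> on \<open>A\<close> has at least two elements,
  and the fibre sizes add up to \<open>card A\<close>.\<close>

lemma card_image_le_half:
  assumes "finite A" and "\<And>a. a \<in> A \<Longrightarrow> \<exists>b \<in> A. b \<noteq> a \<and> f b = f a"
  shows "card (f ` A) \<le> card A div 2"
proof -
  have "2 \<le> card {a \<in> A. f a = y}" if y: "y \<in> f ` A" for y
  proof -
    obtain a b where "a \<in> A" "b \<in> A" "b \<noteq> a" "f a = y" "f b = y"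
      using y assms(2) by fastforce
    then have "card {a, b} \<le> card {a \<in> A. f a = y}"
      using assms(1) by (intro card_mono) auto
    with \<open>b \<noteq> a\<close> show ?thesis by simp
  qed
  then have "(\<Sum>y \<in> f ` A. 2) \<le> (\<Sum>y \<in> f ` A. card {a \<in> A. f a = y})"
    by (rule sum_mono)
  also have "\<dots> = card A"
    using sum.image_gen[OF assms(1), of "\<lambda>_. 1 :: nat" f] by simp
  finally show ?thesis by simp
qed

theorem theorem1p2:
  fixes G :: "'a pair_pre_digraph" and n :: nat
  assumes "pair_graph G"
    and "minimally_2_connected G"
    and "n = card (pverts G)"
    and "n \<ge> 4"
  shows "mvd G \<le> n div 2"
proof -
  have "card (c ` pverts G) \<le> n div 2" if c: "mvd_coloring G c" for c :: "'a \<Rightarrow> nat"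
    unfolding assms(3)
  proof (rule card_image_le_half[OF pair_graph_finite_verts[OF assms(1)]])
    fix v assume "v \<in> pverts G"
    with assms c show "\<exists>w \<in> pverts G. w \<noteq> v \<and> c w = c v"
      by (metis mvd_coloring_no_singleton_class)
  qed
  \<comment> \<open>A bound on each element passes to \<open>Max\<close> because the set is finite
    and nonempty.\<close>
  then show ?thesis
    unfolding mvd_def using mvd_set_finite_nonempty[OF assms(1)] by (subst Max_le_iff) auto
qed

end
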